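(* Consider the linear stochastic evolution equation $dU = A U\,dt + \sigma B\,dW$ on $H$, where $A=A(p)$. Suppose $A=A(p)$ has a discrete spectrum with eigenvalues $\lambda_k=\lambda_k(p)$, $k\in\mathbb{N}$, satisfying $\mathrm{Re}(\lambda_k(p))<0$ for all $k$ and all $p<0$, and eigenfunctions $u_k$. If $k^*$ is such that $\lambda_{k^*}$ is a purely imaginary eigenvalue for $p=0$ and the genericity condition $\langle BQB^*u_{k^*},u_{k^*}\rangle\neq 0$ is satisfied, then the covariance operator $V(t)$ satisfies (for $p<0$) $$\Big\langle \lim_{t\to\infty}V(t)u_k,u_j\Big\rangle = -\sigma^2\,\frac{\langle BQB^*u_k,u_j\rangle}{\lambda_k+\overline{\lambda_j}}\qquad \text{for all } j,k\in\mathbb{N},$$ where $\overline{\lambda_j}$ is the complex conjugate of $\lambda_j$. In particular, $$\Big\langle \lim_{t\to\infty}V(t)u_{k^*},u_{k^*}\Big\rangle = \mathcal{O}\!\left(\frac{1}{\mathrm{Re}(\lambda_{k^*})}\right)\quad\text{as } p\to 0^-.$$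
   Context: $H$ is a Hilbert space with inner product $\langle\cdot,\cdot\rangle$, taken to be conjugate-linear in its first argument and linear in its second. $p\in\mathbb{R}$ is a parameter, and for each $p$ the operator $A=A(p):\mathcal{D}(A)\subset H\to H$ is linear and generates a strongly continuous semigroup $e^{tA}$. $W$ is a (possibly generalized) Wiener process on $H$ with covariance operator $Q$, a non-negative self-adjoint operator on $H$; $\sigma>0$ is a constant; $B$ is a linear operator that is Hilbert–Schmidt from $Q^{1/2}H$ to $H$; the initial condition is $U(0)=0$. A star denotes the adjoint. The mild solution is $U(t)=\sigma\int_0^t e^{(t-s)A}B\,dW_s$, and its covariance operator is $$V(t)=\sigma^2\int_0^t e^{\tau A}BQB^*e^{\tau A^*}\,d\tau .$$ For $p<0$ the steady state $0$ of $\partial_t U=A(p)U$ is stable, and $V_\infty:=\lim_{t\to\infty}V(t)$ satisfies the Lyapunov equation $\langle AV_\infty g,h\rangle+\langle V_\infty A^*g,h\rangle=-\sigma^2\langle BQB^*g,h\rangle$ for all $g,h$ for which the expression is well defined.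
   Formalization: The u_k are taken as eigenfunctions of the adjoint A* for the conjugate eigenvalues (automatic for eigenfunctions of normal A; false for general A), and u_{k*}(p) is assumed bounded as p→0^-, without which the O-estimate fails under rescaling. *)

theory Defs
  imports "HOL-Analysis.Analysis" "HOL-Library.Landau_Symbols"
begin

text \<open>Complex Hilbert spaces. The inner product is conjugate-linear in its first argument and
  linear in its second; completeness comes from \<^class>\<open>banach\<close>.\<close>

class complex_hilbert = banach +
  fixes scaleC :: "complex \<Rightarrow> 'a \<Rightarrow> 'a" (infixr "*\<^sub>C" 75)
    and cinner :: "'a \<Rightarrow> 'a \<Rightarrow> complex"
  assumes scaleR_scaleC: "r *\<^sub>R x = complex_of_real r *\<^sub>C x"
    and scaleC_add_right: "a *\<^sub>C (x + y) = a *\<^sub>C x + a *\<^sub>C y"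
    and scaleC_add_left: "(a + b) *\<^sub>C x = a *\<^sub>C x + b *\<^sub>C x"
    and scaleC_scaleC: "a *\<^sub>C b *\<^sub>C x = (a * b) *\<^sub>C x"
    and cinner_commute: "cinner x y = cnj (cinner y x)"
    and cinner_add_right: "cinner x (y + z) = cinner x y + cinner x z"
    and cinner_scaleC_right: "cinner x (a *\<^sub>C y) = a * cinner x y"
    and cinner_self: "cinner x x = complex_of_real ((norm x)\<^sup>2)"

definition bounded_clinear :: "('h::complex_hilbert \<Rightarrow> 'h) \<Rightarrow> bool" where
  "bounded_clinear f \<longleftrightarrow> bounded_linear f \<and> (\<forall>c x. f (c *\<^sub>C x) = c *\<^sub>C f x)"


text \<open>A possibly unbounded operator is a domain \<open>D\<close> together with a function \<open>A\<close> whose values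
  outside \<open>D\<close> are irrelevant. Its adjoint has domain \<open>adj_dom D A\<close> and action \<open>adj D A\<close>; the
  definite description is determined whenever \<open>D\<close> is dense. For a bounded operator \<open>f\<close> the
  adjoint is \<open>adj UNIV f\<close>.\<close>

definition adj_dom :: "'h::complex_hilbert set \<Rightarrow> ('h \<Rightarrow> 'h) \<Rightarrow> 'h set" where
  "adj_dom D A = {y. \<exists>z. \<forall>x\<in>D. cinner (A x) y = cinner x z}"

definition adj :: "'h::complex_hilbert set \<Rightarrow> ('h \<Rightarrow> 'h) \<Rightarrow> 'h \<Rightarrow> 'h" where
  "adj D A y = (THE z. \<forall>x\<in>D. cinner (A x) y = cinner x z)"

definition eigenvector :: "'h::complex_hilbert set \<Rightarrow> ('h \<Rightarrow> 'h) \<Rightarrow> complex \<Rightarrow> 'h \<Rightarrow> bool" where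
  "eigenvector D A \<mu> u \<longleftrightarrow> u \<in> D \<and> u \<noteq> 0 \<and> A u = \<mu> *\<^sub>C u"

definition spectrum :: "'h::complex_hilbert set \<Rightarrow> ('h \<Rightarrow> 'h) \<Rightarrow> complex set" where
  "spectrum D A = {z. \<not> (\<exists>R. bounded_clinear R \<and>
      (\<forall>x. R x \<in> D \<and> A (R x) - z *\<^sub>C R x = x) \<and> (\<forall>x\<in>D. R (A x - z *\<^sub>C x) = x))}"

text \<open>Finiteness of the multiplicities is deliberately not demanded, so this also covers the
  stricter notion of discrete spectrum.\<close>

definition discrete_spectrum :: "'h::complex_hilbert set \<Rightarrow> ('h \<Rightarrow> 'h) \<Rightarrow> bool" where
  "discrete_spectrum D A \<longleftrightarrow>
    (\<forall>z\<in>spectrum D A. (\<exists>v. eigenvector D A z v) \<and> \<not> z islimpt spectrum D A)"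


definition c0_semigroup :: "(real \<Rightarrow> 'h::complex_hilbert \<Rightarrow> 'h) \<Rightarrow> bool" where
  "c0_semigroup T \<longleftrightarrow>
    (\<forall>t\<ge>0. bounded_clinear (T t)) \<and>
    (\<forall>x. T 0 x = x) \<and>
    (\<forall>s\<ge>0. \<forall>t\<ge>0. \<forall>x. T (s + t) x = T s (T t x)) \<and>
    (\<forall>x. ((\<lambda>t. T t x) \<longlongrightarrow> x) (at_right 0))"

text \<open>\<open>generates D A T\<close>: the operator \<open>A\<close> with domain exactly \<open>D\<close> is the infinitesimal generator
  of \<open>T\<close>, i.e. \<open>T t\<close> is the operator \<open>exp (t A)\<close>.\<close>

definition generates ::
    "'h::complex_hilbert set \<Rightarrow> ('h \<Rightarrow> 'h) \<Rightarrow> (real \<Rightarrow> 'h \<Rightarrow> 'h) \<Rightarrow> bool" where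
  "generates D A T \<longleftrightarrow> c0_semigroup T \<and>
    D = {x. \<exists>y. ((\<lambda>h. (1 / h) *\<^sub>R (T h x - x)) \<longlongrightarrow> y) (at_right 0)} \<and>
    (\<forall>x\<in>D. ((\<lambda>h. (1 / h) *\<^sub>R (T h x - x)) \<longlongrightarrow> A x) (at_right 0))"


definition nonneg_selfadjoint :: "('h::complex_hilbert \<Rightarrow> 'h) \<Rightarrow> bool" where
  "nonneg_selfadjoint Q \<longleftrightarrow> bounded_clinear Q \<and>
    (\<forall>x y. cinner (Q x) y = cinner x (Q y)) \<and> (\<forall>x. 0 \<le> Re (cinner x (Q x)))"

text \<open>In the following \<open>R\<close> stands for \<open>Q\<^sup>1\<^sup>/\<^sup>2\<close>. The Hilbert space \<open>Q\<^sup>1\<^sup>/\<^sup>2 H\<close> is \<open>range R\<close> with the inner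
  product transported by the pseudo-inverse of \<open>R\<close>, which takes values in the orthogonal
  complement of the kernel.\<close>

definition pseudo_inv :: "('h::complex_hilbert \<Rightarrow> 'h) \<Rightarrow> 'h \<Rightarrow> 'h" where
  "pseudo_inv R y = (THE x. R x = y \<and> (\<forall>z. R z = 0 \<longrightarrow> cinner z x = 0))"

definition range_inner :: "('h::complex_hilbert \<Rightarrow> 'h) \<Rightarrow> 'h \<Rightarrow> 'h \<Rightarrow> complex" where
  "range_inner R x y = cinner (pseudo_inv R x) (pseudo_inv R y)"

text \<open>Hilbert-Schmidt operators from a subspace \<open>K\<close>, a Hilbert space under its own inner product
  \<open>ip\<close>, into the ambient space: bounded linear with square-summable values on an orthonormal
  basis (an orthonormal set with trivial orthogonal complement).\<close>

definition hilbert_schmidt ::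
    "'h::complex_hilbert set \<Rightarrow> ('h \<Rightarrow> 'h \<Rightarrow> complex) \<Rightarrow> ('h \<Rightarrow> 'h) \<Rightarrow> bool" where
  "hilbert_schmidt K ip B \<longleftrightarrow>
    (\<forall>x\<in>K. \<forall>y\<in>K. B (x + y) = B x + B y) \<and>
    (\<forall>c. \<forall>x\<in>K. B (c *\<^sub>C x) = c *\<^sub>C B x) \<and>
    (\<exists>C. \<forall>x\<in>K. (norm (B x))\<^sup>2 \<le> C * Re (ip x x)) \<and>
    (\<exists>E\<subseteq>K. (\<forall>e\<in>E. \<forall>f\<in>E. ip e f = (if e = f then 1 else 0)) \<and>
            (\<forall>x\<in>K. (\<forall>e\<in>E. ip e x = 0) \<longrightarrow> x = 0) \<and>
            (\<lambda>e. (norm (B e))\<^sup>2) summable_on E)"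

text \<open>The operator \<open>B Q B\<^sup>*\<close>. As \<open>B\<close> need only be defined on \<open>Q\<^sup>1\<^sup>/\<^sup>2 H\<close>, it is read as
  \<open>(B Q\<^sup>1\<^sup>/\<^sup>2) (B Q\<^sup>1\<^sup>/\<^sup>2)\<^sup>*\<close>; if \<open>B\<close> has an adjoint on the whole space this is the literal product,
  see \<open>BQB_eq\<close> below.\<close>

definition BQB :: "('h::complex_hilbert \<Rightarrow> 'h) \<Rightarrow> ('h \<Rightarrow> 'h) \<Rightarrow> 'h \<Rightarrow> 'h" where
  "BQB B R = (\<lambda>x. B (R (adj UNIV (\<lambda>y. B (R y)) x)))"

text \<open>\<open>V(t)\<close>, as a strong integral. The operator \<open>exp (\<tau> A\<^sup>*)\<close> is the adjoint of \<open>exp (\<tau> A)\<close>.\<close>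

definition covariance ::
    "(real \<Rightarrow> 'h::complex_hilbert \<Rightarrow> 'h) \<Rightarrow> ('h \<Rightarrow> 'h) \<Rightarrow> real \<Rightarrow> real \<Rightarrow> 'h \<Rightarrow> 'h" where
  "covariance T G \<sigma> t x = \<sigma>\<^sup>2 *\<^sub>R integral {0..t} (\<lambda>\<tau>. T \<tau> (G (adj UNIV (T \<tau>) x)))"


lemma cinner_diff_right: "cinner x (y - z) = cinner x y - cinner x (z::'h::complex_hilbert)"
  by (metis add_diff_cancel cinner_add_right diff_add_cancel)

lemma cinner_add_left: "cinner (x + y) z = cinner x z + cinner y (z::'h::complex_hilbert)"
  by (metis cinner_add_right cinner_commute complex_cnj_add)

lemma cinner_diff_left: "cinner (x - y) z = cinner x z - cinner y (z::'h::complex_hilbert)"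
  by (metis cinner_commute cinner_diff_right complex_cnj_diff)

lemma cinner_scaleC_left: "cinner (a *\<^sub>C x) y = cnj a * cinner x (y::'h::complex_hilbert)"
  by (metis cinner_commute cinner_scaleC_right complex_cnj_mult)

lemma cinner_eqI:
  assumes "\<And>x. cinner x y = cinner x (z::'h::complex_hilbert)"
  shows "y = z"
proof -
  have "cinner (y - z) (y - z) = 0"
    using assms by (simp add: cinner_diff_right)
  then show ?thesis
    by (simp add: cinner_self)
qed

lemma BQB_eq:
  assumes Bs: "\<And>x y. cinner (B x) y = cinner x (Bs y)"
    and R: "\<And>x y. cinner (R x) y = cinner x (R y)"
    and Q: "\<And>x. R (R x) = Q x"
  shows "BQB B R x = B (Q (Bs x))"
proof -
  have "adj UNIV (\<lambda>y. B (R y)) x = R (Bs x)"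
    unfolding adj_def
    by (rule the_equality) (auto simp: Bs R intro: cinner_eqI)
  then show ?thesis
    by (simp add: BQB_def Q)
qed

text \<open>Evaluating \<open>V(t)\<close> on \<open>u\<close> involves \<open>exp (\<tau> A\<^sup>*) u\<close>, so the relevant eigenfunctions are those of
  \<open>A\<^sup>*\<close>, to the conjugate eigenvalues. For normal \<open>A\<close> every eigenfunction of \<open>A\<close> is one of these. The
  assumption \<open>ad\<close> holds by definition of the adjoint when \<open>D\<close> is dense.\<close>

lemma normal_eigenvector:
  assumes dom: "adj_dom D A = D"
    and ad: "\<And>x y. x \<in> D \<Longrightarrow> y \<in> D \<Longrightarrow> cinner (A x) y = cinner x (adj D A y)"
    and normal: "\<And>x. x \<in> D \<Longrightarrow> norm (adj D A x) = norm (A x)"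
    and ev: "eigenvector D A \<mu> u"
  shows "eigenvector (adj_dom D A) (adj D A) (cnj \<mu>) u"
proof -
  have u: "u \<in> D" "u \<noteq> 0" "A u = \<mu> *\<^sub>C u"
    using ev by (auto simp: eigenvector_def)
  have ns: "cinner (adj D A u) (adj D A u) = cinner (A u) (A u)"
    using normal[OF u(1)] by (simp add: cinner_self)
  have c1: "cinner u (adj D A u) = cnj \<mu> * cinner u u"
    using ad[OF u(1) u(1)] by (simp add: u cinner_scaleC_left)
  have c2: "cinner (adj D A u) u = \<mu> * cinner u u"
    by (metis c1 cinner_commute complex_cnj_cnj complex_cnj_mult)
  have "cinner (adj D A u - cnj \<mu> *\<^sub>C u) (adj D A u - cnj \<mu> *\<^sub>C u) = 0"
    by (simp add: cinner_diff_left cinner_diff_right cinner_scaleC_left cinner_scaleC_right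
        ns c1 c2 u(3) algebra_simps)
  then have "adj D A u = cnj \<mu> *\<^sub>C u"
    by (simp add: cinner_self)
  then show ?thesis
    using u dom by (simp add: eigenvector_def)
qed

end

theory Submission imports Defs begin

text \<open>The covariance \<open>V(t)\<close> is tested against eigenvectors \<open>u\<^sub>k\<close> of the adjoint generator \<open>A\<^sup>*\<close>, to
  the eigenvalues \<open>cnj \<lambda>\<^sub>k\<close>. On such a vector \<open>exp (\<tau> A\<^sup>*)\<close> is multiplication by
  \<open>exp (\<tau> cnj \<lambda>\<^sub>k)\<close> (\<open>adj_semigroup_eigenvector\<close>). Moving \<open>exp (\<tau> A)\<close> to the other side of the
  inner product therefore turns both semigroup factors into scalars, and
  \<open>\<langle>V(t) u\<^sub>k, u\<^sub>j\<rangle> = \<sigma>\<^sup>2 \<langle>BQB\<^sup>* u\<^sub>k, u\<^sub>j\<rangle> \<integral>\<^sub>0\<^sup>t exp (\<tau> (\<lambda>\<^sub>k + cnj \<lambda>\<^sub>j)) d\<tau>\<close>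
  (\<open>cinner_covariance_eigenvectors\<close>). As both eigenvalues lie in the open left half plane, the scalar
  integral tends to \<open>- 1 / (\<lambda>\<^sub>k + cnj \<lambda>\<^sub>j)\<close>. On the diagonal the denominator is \<open>2 Re \<lambda>\<close>, and the
  numerator is bounded because the eigenvectors are and \<open>BQB\<^sup>*\<close> is a fixed bounded operator; this
  gives the growth rate.

  Two bodies of theory make this rigorous. In the Hilbert space, orthogonal projection and the Riesz
  representation theorem provide adjoints of bounded operators; projection onto the orthogonal
  complement of the kernel of \<open>Q\<^sup>1\<^sup>/\<^sup>2\<close> also shows that the transported norm of \<open>Q\<^sup>1\<^sup>/\<^sup>2 x\<close> is at most
  the norm of \<open>x\<close>, so that \<open>B Q\<^sup>1\<^sup>/\<^sup>2\<close>, and with it \<open>BQB\<^sup>*\<close>, is bounded (\<open>bounded_clinear_BQB\<close>). For the semigroup, the uniform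
  boundedness principle yields strong continuity, and then \<open>\<integral>\<^sub>0\<^sup>t exp (s A) x ds\<close> lies in the domain of
  \<open>A\<close> and is mapped to \<open>exp (t A) x - x\<close> (\<open>integral_orbit_in_domain\<close>). Pairing this identity with an
  eigenvector of \<open>A\<^sup>*\<close> gives a scalar integral equation whose only solution is the exponential. Since
  \<open>1 / t\<close> times these integrals converges to \<open>x\<close>, the domain is dense, which is what makes the
  adjoint of \<open>A\<close> well defined.\<close>

section \<open>Geometry of complex Hilbert spaces\<close>

lemma cinner_zero_left [simp]: "cinner 0 (x::'h::complex_hilbert) = 0"
  by (metis cinner_diff_left diff_self)

lemma cinner_zero_right [simp]: "cinner (x::'h::complex_hilbert) 0 = 0"
  by (metis cinner_diff_right diff_self)

lemma cinner_scaleR_left: "cinner (r *\<^sub>R x) y = of_real r * cinner x (y::'h::complex_hilbert)"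
  by (simp add: scaleR_scaleC cinner_scaleC_left)

lemma cinner_scaleR_right: "cinner x (r *\<^sub>R y) = of_real r * cinner x (y::'h::complex_hilbert)"
  by (simp add: scaleR_scaleC cinner_scaleC_right)

text \<open>Subtracting a multiple of the component along \<open>w\<close> costs or gains a quadratic in the step \<open>t\<close>.
  The vertex \<open>t = 1 / (norm w)\<^sup>2\<close> yields the Cauchy-Schwarz inequality; a shorter positive step
  shows that a nearest point leaves an orthogonal remainder.\<close>

lemma norm_diff_projection:
  "(norm (v - (of_real t * cinner w v) *\<^sub>C w))\<^sup>2
     = (norm v)\<^sup>2 - t * (2 - t * (norm w)\<^sup>2) * (cmod (cinner w (v::'h::complex_hilbert)))\<^sup>2"
proof -
  define a where "a = cinner w v"
  define d where "d = v - (of_real t * a) *\<^sub>C w"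
  have vw: "cinner v w = cnj a"
    unfolding a_def by (rule cinner_commute)
  have "complex_of_real ((norm d)\<^sup>2) = cinner d d"
    by (rule cinner_self[symmetric])
  also have "\<dots> = cinner v v - 2 * of_real t * (a * cnj a) + of_real t * of_real t * (a * cnj a) * cinner w w"
    unfolding d_def cinner_diff_left cinner_diff_right cinner_scaleC_left cinner_scaleC_right vw
      a_def[symmetric] by (simp add: algebra_simps)
  also have "\<dots> = of_real ((norm v)\<^sup>2 - t * (2 - t * (norm w)\<^sup>2) * (cmod a)\<^sup>2)"
    unfolding cinner_self complex_norm_square[symmetric] by (simp add: algebra_simps)
  finally show ?thesis
    unfolding d_def a_def using of_real_eq_iff by blast
qed

lemma cauchy_schwarz: "cmod (cinner x y) \<le> norm x * norm (y::'h::complex_hilbert)"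
proof (cases "x = 0")
  case False
  have "0 \<le> (norm y)\<^sup>2 - 1 / (norm x)\<^sup>2 * (2 - 1 / (norm x)\<^sup>2 * (norm x)\<^sup>2) * (cmod (cinner x y))\<^sup>2"
    unfolding norm_diff_projection[symmetric] by simp
  then have "(cmod (cinner x y))\<^sup>2 \<le> (norm x * norm y)\<^sup>2"
    using False by (simp add: field_simps power_mult_distrib)
  then show ?thesis
    by (rule power2_le_imp_le) simp
qed simp

lemma bounded_linear_cinner_left: "bounded_linear (\<lambda>x. cinner x (y::'h::complex_hilbert))"
  by (rule bounded_linear_intro[where K = "norm y"])
    (auto simp: cinner_add_left cinner_scaleR_left cauchy_schwarz scaleR_conv_of_real)

lemma norm_scaleC: "norm (c *\<^sub>C x) = cmod c * norm (x::'h::complex_hilbert)"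
proof -
  have "complex_of_real ((norm (c *\<^sub>C x))\<^sup>2) = (c * cnj c) * cinner x x"
    unfolding cinner_self[symmetric] cinner_scaleC_left cinner_scaleC_right by simp
  also have "\<dots> = of_real ((cmod c * norm x)\<^sup>2)"
    unfolding complex_norm_square[symmetric] cinner_self by (simp add: power_mult_distrib)
  finally have "(norm (c *\<^sub>C x))\<^sup>2 = (cmod c * norm x)\<^sup>2"
    using of_real_eq_iff by blast
  then show ?thesis
    by (simp add: power2_eq_iff_nonneg)
qed

lemma bounded_bilinear_scaleC: "bounded_bilinear ((*\<^sub>C) :: complex \<Rightarrow> 'h \<Rightarrow> 'h::complex_hilbert)"
proof
  show "\<exists>K. \<forall>a b. norm (a *\<^sub>C b :: 'h) \<le> norm a * norm b * K"
    by (rule exI[of _ 1]) (simp add: norm_scaleC)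
qed (simp_all add: scaleC_add_left scaleC_add_right scaleR_scaleC scaleC_scaleC
     scaleR_conv_of_real mult_ac)

lemma parallelogram:
  "(norm (x + y))\<^sup>2 + (norm (x - y))\<^sup>2 = 2 * (norm x)\<^sup>2 + 2 * (norm (y::'h::complex_hilbert))\<^sup>2"
proof -
  have "complex_of_real ((norm (x + y))\<^sup>2 + (norm (x - y))\<^sup>2)
      = of_real (2 * (norm x)\<^sup>2 + 2 * (norm y)\<^sup>2)"
    unfolding of_real_add of_real_mult cinner_self[symmetric]
    by (simp add: cinner_diff_left cinner_diff_right cinner_add_left cinner_add_right algebra_simps)
  then show ?thesis
    using of_real_eq_iff by blast
qed

text \<open>A minimising sequence is Cauchy: the midpoint of two of its members lies in the convex set, hence
  is no closer than the infimum, and the parallelogram law then forces the members together.\<close>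

lemma nearest_point_exists:
  fixes x :: "'h::complex_hilbert"
  assumes cl: "closed M" and ne: "M \<noteq> {}" and conv: "convex M"
  obtains m where "m \<in> M" "\<And>w. w \<in> M \<Longrightarrow> norm (x - m) \<le> norm (x - w)"
proof -
  define r where "r = (\<lambda>n. 1 / real (Suc n))"
  define e where "e = (INF m\<in>M. (norm (x - m))\<^sup>2)"
  have bdd: "bdd_below ((\<lambda>m. (norm (x - m))\<^sup>2) ` M)"
    by (rule bdd_belowI2[of _ 0]) simp
  have e: "e \<le> (norm (x - m))\<^sup>2" if "m \<in> M" for m
    unfolding e_def using bdd that by (rule cINF_lower)
  have "\<exists>m\<in>M. (norm (x - m))\<^sup>2 < e + r n" for n
    using cINF_less_iff[OF ne bdd, of "e + r n"] by (simp add: e_def r_def)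
  then obtain m where mM: "\<And>n. m n \<in> M" and m: "\<And>n. (norm (x - m n))\<^sup>2 < e + r n"
    by metis
  have close: "(norm (m i - m j))\<^sup>2 \<le> 2 * (r i + r j)" for i j
  proof -
    have "(1/2) *\<^sub>R m i + (1/2) *\<^sub>R m j \<in> M"
      using conv mM by (auto simp: convex_def)
    from e[OF this] have "4 * e \<le> 4 * (norm (x - ((1/2) *\<^sub>R m i + (1/2) *\<^sub>R m j)))\<^sup>2"
      by simp
    also have "\<dots> = (norm (2 *\<^sub>R (x - ((1/2) *\<^sub>R m i + (1/2) *\<^sub>R m j))))\<^sup>2"
      by (simp add: power_mult_distrib)
    also have "2 *\<^sub>R (x - ((1/2) *\<^sub>R m i + (1/2) *\<^sub>R m j)) = (x - m i) + (x - m j)"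
      by (simp add: algebra_simps scaleR_2)
    finally have "4 * e \<le> (norm ((x - m i) + (x - m j)))\<^sup>2" .
    moreover have "norm (m i - m j) = norm ((x - m i) - (x - m j))"
      by (simp add: norm_minus_commute)
    ultimately show ?thesis
      using parallelogram[of "x - m i" "x - m j"] m[of i] m[of j] by auto
  qed
  have "Cauchy m"
    unfolding Cauchy_iff
  proof (intro allI impI)
    fix \<epsilon> :: real
    assume \<epsilon>: "\<epsilon> > 0"
    obtain N where N: "r N < \<epsilon>\<^sup>2 / 4"
      unfolding r_def using \<epsilon> by (metis nat_approx_posE zero_less_divide_iff zero_less_numeral zero_less_power)
    have "norm (m i - m j) < \<epsilon>" if "i \<ge> N" "j \<ge> N" for i j
    proof -
      have "r i \<le> r N" "r j \<le> r N"
        using that by (auto simp: r_def field_simps)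
      then have "2 * (r i + r j) \<le> 4 * r N"
        by simp
      also have "\<dots> < \<epsilon>\<^sup>2"
        using N by simp
      finally have "(norm (m i - m j))\<^sup>2 < \<epsilon>\<^sup>2"
        using close[of i j] by (rule le_less_trans[rotated])
      then show ?thesis
        using \<epsilon> by (metis less_imp_le power2_less_imp_less)
    qed
    then show "\<exists>N. \<forall>i\<ge>N. \<forall>j\<ge>N. norm (m i - m j) < \<epsilon>"
      by blast
  qed
  then obtain l where l: "m \<longlonglongrightarrow> l"
    using Cauchy_convergent convergent_def by blast
  have "l \<in> M"
    using closed_sequentially[OF cl _ l] mM by simp
  moreover have "norm (x - l) \<le> norm (x - w)" if "w \<in> M" for w
  proof -
    have 1: "(\<lambda>n. (norm (x - m n))\<^sup>2) \<longlonglongrightarrow> (norm (x - l))\<^sup>2"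
      by (intro tendsto_intros l)
    have 2: "(\<lambda>n. e + r n) \<longlonglongrightarrow> e + 0"
      unfolding r_def by (intro tendsto_intros LIMSEQ_Suc lim_1_over_n)
    have "(norm (x - l))\<^sup>2 \<le> e + 0"
      by (rule LIMSEQ_le[OF 1 2]) (use m less_imp_le in blast)
    also have "\<dots> \<le> (norm (x - w))\<^sup>2"
      using e[OF that] by simp
    finally show ?thesis
      by (rule power2_le_imp_le) simp
  qed
  ultimately show ?thesis
    by (rule that)
qed

lemma orthogonal_projection_exists:
  fixes x :: "'h::complex_hilbert"
  assumes cl: "closed M" and zero: "0 \<in> M"
    and add: "\<And>v w. v \<in> M \<Longrightarrow> w \<in> M \<Longrightarrow> v + w \<in> M"
    and scale: "\<And>c w. w \<in> M \<Longrightarrow> c *\<^sub>C w \<in> M"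
  obtains m where "m \<in> M" "\<And>w. w \<in> M \<Longrightarrow> cinner w (x - m) = 0"
proof -
  have "convex M"
    unfolding convex_def by (auto intro!: add simp: scaleR_scaleC scale)
  then obtain m where m: "m \<in> M" and best: "\<And>w. w \<in> M \<Longrightarrow> norm (x - m) \<le> norm (x - w)"
    using nearest_point_exists[OF cl, of x] zero by blast
  have "cinner w (x - m) = 0" if w: "w \<in> M" for w
  proof -
    define a where "a = cinner w (x - m)"
    \<comment> \<open>The summand \<open>1\<close> covers \<open>w = 0\<close> and keeps \<open>t\<close> strictly below twice the optimal step.\<close>
    define t where "t = 1 / ((norm w)\<^sup>2 + 1)"
    have t: "t > 0" "t * (norm w)\<^sup>2 \<le> 1"
      by (auto simp: t_def field_simps add_pos_nonneg)
    have "m + (of_real t * a) *\<^sub>C w \<in> M"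
      by (intro add scale m w)
    from best[OF this] have "(norm (x - m))\<^sup>2 \<le> (norm ((x - m) - (of_real t * a) *\<^sub>C w))\<^sup>2"
      by (simp add: diff_diff_add)
    then have "t * (2 - t * (norm w)\<^sup>2) * (cmod a)\<^sup>2 \<le> 0"
      unfolding a_def norm_diff_projection by simp
    moreover have "t * (2 - t * (norm w)\<^sup>2) > 0"
      using t by simp
    ultimately have "(cmod a)\<^sup>2 \<le> 0"
      by (metis linorder_not_le mult_pos_pos)
    then show ?thesis
      by (simp add: a_def)
  qed
  with m show ?thesis
    by (rule that)
qed

text \<open>The functional is conjugate-linear because the inner product is so in its first argument. A
  vector \<open>v\<close> orthogonal to the kernel represents it up to scaling, since subtracting a suitable
  multiple of \<open>v\<close> moves every \<open>y\<close> into the kernel.\<close>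

lemma riesz_representation:
  fixes \<phi> :: "'h::complex_hilbert \<Rightarrow> complex"
  assumes lin: "bounded_linear \<phi>" and conj: "\<And>c x. \<phi> (c *\<^sub>C x) = cnj c * \<phi> x"
  obtains z where "\<And>y. \<phi> y = cinner y z"
proof (cases "\<forall>y. \<phi> y = 0")
  case True
  then show ?thesis
    by (intro that[of 0]) simp
next
  case False
  then obtain x where x: "\<phi> x \<noteq> 0"
    by blast
  interpret bounded_linear \<phi> by (rule lin)
  let ?M = "{y. \<phi> y = 0}"
  have "closed ?M"
    by (intro closed_Collect_eq continuous_on continuous_on_const) (auto intro: tendsto_intros)
  then obtain m where m: "\<phi> m = 0" and orth: "\<And>w. \<phi> w = 0 \<Longrightarrow> cinner w (x - m) = 0"
    using orthogonal_projection_exists[of ?M x] by (auto simp: add conj zero)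
  define v where "v = x - m"
  have \<phi>v: "\<phi> v \<noteq> 0"
    using x m by (simp add: v_def diff)
  have v: "v \<noteq> 0"
    using \<phi>v zero by auto
  have "\<phi> y = cinner y ((\<phi> v / of_real ((norm v)\<^sup>2)) *\<^sub>C v)" for y
  proof -
    have "\<phi> (y - cnj (\<phi> y / \<phi> v) *\<^sub>C v) = 0"
      using \<phi>v by (simp add: diff conj)
    then have "cinner (y - cnj (\<phi> y / \<phi> v) *\<^sub>C v) v = 0"
      unfolding v_def by (rule orth)
    then have "cinner y v = \<phi> y / \<phi> v * of_real ((norm v)\<^sup>2)"
      by (simp add: cinner_diff_left cinner_scaleC_left cinner_self)
    then show ?thesis
      using \<phi>v v by (simp add: cinner_scaleC_right)
  qed
  then show ?thesis
    by (rule that)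
qed

lemma adj_eqI:
  assumes "\<And>x. cinner (f x) y = cinner x (z::'h::complex_hilbert)"
  shows "adj UNIV f y = z"
  unfolding adj_def by (rule the_equality) (use assms in \<open>auto intro: cinner_eqI\<close>)

section \<open>Adjoints and the operator BQB*\<close>

text \<open>The Riesz theorem supplies the vector that the definite description of the adjoint asks
  for.\<close>

lemma cinner_adj:
  assumes "bounded_clinear (f::'h::complex_hilbert \<Rightarrow> 'h)"
  shows "cinner (f x) y = cinner x (adj UNIV f y)"
proof -
  have "bounded_linear (\<lambda>x. cinner (f x) y)"
    using assms bounded_linear_compose[OF bounded_linear_cinner_left]
    by (auto simp: bounded_clinear_def)
  then obtain z where z: "\<And>x. cinner (f x) y = cinner x z"
    by (rule riesz_representation[of "\<lambda>x. cinner (f x) y"])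
      (use assms in \<open>auto simp: bounded_clinear_def cinner_scaleC_left\<close>)
  then show ?thesis
    by (metis adj_eqI)
qed

lemma bounded_clinear_adj:
  assumes f: "bounded_clinear (f::'h::complex_hilbert \<Rightarrow> 'h)"
  shows "bounded_clinear (adj UNIV f)"
proof -
  interpret bounded_linear f
    using f by (simp add: bounded_clinear_def)
  obtain K where K: "K \<ge> 0" "\<And>x. norm (f x) \<le> norm x * K"
    using nonneg_bounded by blast
  have scale: "adj UNIV f (c *\<^sub>C x) = c *\<^sub>C adj UNIV f x" for c x
    by (rule adj_eqI) (simp add: cinner_scaleC_right cinner_adj[OF f])
  have "norm (adj UNIV f y) \<le> norm y * K" for y
  proof -
    define z where "z = adj UNIV f y"
    have "(norm z)\<^sup>2 = cmod (cinner z z)"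
      by (simp add: cinner_self norm_power)
    also have "\<dots> = cmod (cinner (f z) y)"
      by (simp add: cinner_adj[OF f] z_def)
    also have "\<dots> \<le> norm (f z) * norm y"
      by (rule cauchy_schwarz)
    also have "\<dots> \<le> (norm z * K) * norm y"
      by (intro mult_right_mono K) simp
    finally have "norm z * norm z \<le> norm z * (norm y * K)"
      by (simp add: power2_eq_square mult_ac)
    then show ?thesis
      using K unfolding z_def[symmetric] 
      by (metis mult_le_cancel_left_pos mult_nonneg_nonneg norm_ge_zero order_le_less)
  qed
  then have "bounded_linear (adj UNIV f)"
    by (intro bounded_linear_intro[where K = K])
      (auto intro!: adj_eqI simp: cinner_add_right cinner_scaleR_right cinner_adj[OF f])
  then show ?thesis
    using scale by (simp add: bounded_clinear_def)
qed

text \<open>The pseudo-inverse of \<open>R x\<close> is the component of \<open>x\<close> orthogonal to the kernel of \<open>R\<close>. So the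
  norm that \<open>R\<close> transports to its range is at most the norm of any preimage.\<close>

lemma pseudo_inv_norm_le:
  assumes R: "bounded_clinear (R::'h::complex_hilbert \<Rightarrow> 'h)"
  shows "norm (pseudo_inv R (R x)) \<le> norm x"
proof -
  interpret bounded_linear R
    using R by (simp add: bounded_clinear_def)
  have scale: "R (c *\<^sub>C y) = c *\<^sub>C R y" for c y
    using R by (simp add: bounded_clinear_def)
  have [simp]: "c *\<^sub>C 0 = (0::'h)" for c
    by (metis add_cancel_right_left scaleC_add_right)
  have "closed {y. R y = 0}"
    by (intro closed_Collect_eq continuous_on continuous_on_const) (auto intro: tendsto_intros)
  then obtain m where m: "R m = 0" and orth: "\<And>w. R w = 0 \<Longrightarrow> cinner w (x - m) = 0"
    using orthogonal_projection_exists[of "{y. R y = 0}" x] by (auto simp: add scale zero)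
  have "pseudo_inv R (R x) = x - m"
    unfolding pseudo_inv_def
  proof (rule the_equality)
    fix y
    assume y: "R y = R x \<and> (\<forall>z. R z = 0 \<longrightarrow> cinner z y = 0)"
    define d where "d = y - (x - m)"
    have "R d = 0"
      using y m by (simp add: d_def diff)
    then have "cinner d d = 0"
      using y orth by (simp add: d_def cinner_diff_right[of "y - (x - m)" y])
    then show "y = x - m"
      by (simp add: cinner_self d_def)
  qed (use m orth in \<open>simp add: diff\<close>)
  moreover have "norm (x - m) \<le> norm x"
  proof -
    have "(norm (x - m))\<^sup>2 = cmod (cinner (x - m) (x - m))"
      by (simp add: cinner_self norm_power)
    also have "\<dots> = cmod (cinner x (x - m))"
      using orth[OF m] by (simp add: cinner_diff_left)
    also have "\<dots> \<le> norm x * norm (x - m)"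
      by (rule cauchy_schwarz)
    finally show ?thesis
      by (cases "norm (x - m) = 0") (auto simp: power2_eq_square)
  qed
  ultimately show ?thesis
    by simp
qed

text \<open>Boundedness of \<open>B\<close> is relative to the transported norm on the range of \<open>R\<close>, which the
  ambient norm need not control; it is composing with \<open>R\<close> that gives an operator bounded on the whole
  space.\<close>

lemma hilbert_schmidt_compose_bounded:
  assumes R: "bounded_clinear (R::'h::complex_hilbert \<Rightarrow> 'h)"
    and B: "hilbert_schmidt (range R) (range_inner R) B"
  shows "bounded_clinear (\<lambda>x. B (R x))"
proof -
  interpret bounded_linear R
    using R by (simp add: bounded_clinear_def)
  have R_scale: "R (c *\<^sub>C y) = c *\<^sub>C R y" for c y
    using R by (simp add: bounded_clinear_def)
  have B_add: "B (R x + R y) = B (R x) + B (R y)" for x y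
    using B by (simp add: hilbert_schmidt_def)
  have B_scale: "B (c *\<^sub>C R x) = c *\<^sub>C B (R x)" for c x
    using B by (simp add: hilbert_schmidt_def)
  obtain C where C: "\<And>x. (norm (B (R x)))\<^sup>2 \<le> C * Re (range_inner R (R x) (R x))"
    using B by (auto simp: hilbert_schmidt_def)
  have "norm (B (R x)) \<le> norm x * sqrt \<bar>C\<bar>" for x
  proof -
    have "(norm (B (R x)))\<^sup>2 \<le> C * (norm (pseudo_inv R (R x)))\<^sup>2"
      using C[of x] by (simp add: range_inner_def cinner_self)
    also have "\<dots> \<le> \<bar>C\<bar> * (norm x)\<^sup>2"
      by (intro mult_mono power_mono pseudo_inv_norm_le R) auto
    also have "\<dots> = (norm x * sqrt \<bar>C\<bar>)\<^sup>2"
      by (simp add: power_mult_distrib)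
    finally show ?thesis
      by (rule power2_le_imp_le) simp
  qed
  then have "bounded_linear (\<lambda>x. B (R x))"
    by (intro bounded_linear_intro[where K = "sqrt \<bar>C\<bar>"])
      (auto simp: add B_add scaleR_scaleC R_scale B_scale)
  then show ?thesis
    by (simp add: bounded_clinear_def R_scale B_scale)
qed

lemma bounded_clinear_BQB:
  assumes "bounded_clinear (R::'h::complex_hilbert \<Rightarrow> 'h)"
    and "hilbert_schmidt (range R) (range_inner R) B"
  shows "bounded_clinear (BQB B R)"
proof -
  let ?L = "\<lambda>x. B (R x)"
  have L: "bounded_clinear ?L"
    using assms by (rule hilbert_schmidt_compose_bounded)
  have "bounded_linear (\<lambda>x. ?L (adj UNIV ?L x))"
    using L bounded_clinear_adj[OF L] unfolding bounded_clinear_def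
    by (blast intro: bounded_linear_compose[of ?L])
  with L bounded_clinear_adj[OF L] show ?thesis
    by (simp add: bounded_clinear_def BQB_def)
qed


section \<open>Uniform boundedness and scalar exponentials\<close>

text \<open>By Baire, one of the closed sets on which all \<open>f i\<close> are bounded by a given \<open>n\<close> contains a
  ball; differences of points of that ball reach all directions.\<close>

theorem uniform_boundedness:
  fixes f :: "'i \<Rightarrow> 'a::banach \<Rightarrow> 'b::real_normed_vector"
  assumes lin: "\<And>i. bounded_linear (f i)"
    and ptw: "\<And>x. \<exists>K. \<forall>i. norm (f i x) \<le> K"
  obtains K where "K \<ge> 0" "\<And>i x. norm (f i x) \<le> K * norm x"
proof -
  define C where "C = (\<lambda>n::nat. {x. \<forall>i. norm (f i x) \<le> real n})"
  have closed: "closed (C n)" for n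
    unfolding C_def
    by (intro closed_Collect_all closed_Collect_le continuous_on_const continuous_on_norm
        linear_continuous_on lin)
  have "x \<in> \<Union>(range C)" for x
  proof -
    obtain K where K: "\<And>i. norm (f i x) \<le> K"
      using ptw by blast
    obtain n where "K \<le> real n"
      using real_arch_simple by blast
    then have "x \<in> C n"
      using K order_trans by (auto simp: C_def)
    then show ?thesis
      by blast
  qed
  then have cover: "\<Union>(range C) = UNIV"
    by blast
  have "\<exists>n. interior (C n) \<noteq> {}"
  proof (rule ccontr)
    assume "\<not> ?thesis"
    then have "interior (\<Union>(range C)) = {}"
      using Baire_category_alt[of euclidean "range C"] completely_metrizable_space_euclidean closed
      by auto
    then show False
      unfolding cover by simp
  qed
  then obtain n a where "a \<in> interior (C n)"
    by blast
  then obtain e where e: "e > 0" "cball a e \<subseteq> C n"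
    unfolding mem_interior_cball by blast
  have "norm (f i x) \<le> 2 * real n / e * norm x" for i x
  proof (cases "x = 0")
    case True
    then show ?thesis
      using linear_0[OF bounded_linear.linear[OF lin]] by simp
  next
    case False
    interpret bounded_linear "f i" by (rule lin)
    \<comment> \<open>Scales \<open>x\<close> to the radius of the ball, so that \<open>a + c *\<^sub>R x\<close> lies on its boundary.\<close>
    define c where "c = e / norm x"
    have c: "c > 0"
      using e False by (simp add: c_def)
    have "a \<in> C n" "a + c *\<^sub>R x \<in> C n"
      using e False by (auto simp: c_def dist_norm subset_iff)
    then have "norm (f i a) \<le> n" "norm (f i (a + c *\<^sub>R x)) \<le> n"
      by (auto simp: C_def)
    then have "norm (f i (a + c *\<^sub>R x) - f i a) \<le> 2 * real n"
      using norm_triangle_ineq4[of "f i (a + c *\<^sub>R x)" "f i a"] by linarith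
    also have "f i (a + c *\<^sub>R x) - f i a = c *\<^sub>R f i x"
      by (simp add: add scaleR)
    finally have "norm (c *\<^sub>R f i x) \<le> 2 * real n" .
    then have "c * norm (f i x) \<le> 2 * n"
      using c by simp
    then show ?thesis
      using e False by (simp add: c_def field_simps)
  qed
  moreover have "2 * real n / e \<ge> 0"
    using e by simp
  ultimately show ?thesis
    using that by blast
qed

lemma tendsto_integral_average:
  fixes g :: "real \<Rightarrow> 'a::banach"
  assumes "continuous_on {0..1} g"
  shows "((\<lambda>h. (1 / h) *\<^sub>R integral {0..h} g) \<longlongrightarrow> g 0) (at_right 0)"
proof -
  have "((\<lambda>h. integral {0..h} g) has_vector_derivative g 0) (at 0 within {0..1})"
    using assms by (rule integral_has_vector_derivative) simp
  then have "((\<lambda>h. (1 / norm h) *\<^sub>R (integral {0..h} g - h *\<^sub>R g 0)) \<longlongrightarrow> 0) (at_right 0)"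
    by (simp add: has_vector_derivative_def has_derivative_within at_within_Icc_at_right divide_inverse)
  moreover have "\<forall>\<^sub>F h in at_right 0. (1 / norm h) *\<^sub>R (integral {0..h} g - h *\<^sub>R g 0)
      = (1 / h) *\<^sub>R integral {0..h} g - g 0"
    unfolding eventually_at_right_field
    by (rule exI[of _ 1]) (auto simp: scaleR_diff_right)
  ultimately have "((\<lambda>h. (1 / h) *\<^sub>R integral {0..h} g - g 0) \<longlongrightarrow> 0) (at_right 0)"
    by (rule Lim_transform_eventually)
  then show ?thesis
    by (simp add: LIM_zero_iff)
qed

text \<open>The integral equation makes \<open>g\<close> differentiable with \<open>g' = c g\<close>, so that \<open>exp (- t c) g(t)\<close> is
  constant. In the integrated form the equation makes sense for every orbit of a semigroup, also for
  initial vectors outside the domain of the generator.\<close>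

lemma volterra_exponential:
  fixes g :: "real \<Rightarrow> complex"
  assumes cont: "continuous_on {0..b} g" and b: "b \<ge> 0"
    and eq: "\<And>t. t \<in> {0..b} \<Longrightarrow> g t = g 0 + c * integral {0..t} g"
  shows "g b = exp (of_real b * c) * g 0"
proof -
  have g': "(g has_vector_derivative c * g t) (at t within {0..b})" if t: "t \<in> {0..b}" for t
  proof -
    have "((\<lambda>t. g 0 + c * integral {0..t} g) has_vector_derivative 0 + c * g t) (at t within {0..b})"
      by (intro has_vector_derivative_add has_vector_derivative_mult_right
          has_vector_derivative_const integral_has_vector_derivative cont t)
    then have "((\<lambda>t. g 0 + c * integral {0..t} g) has_vector_derivative c * g t) (at t within {0..b})"
      by simp
    then show ?thesis
      by (rule has_vector_derivative_transform[OF t, rotated]) (rule eq)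
  qed
  have "((\<lambda>t. exp (- (of_real t * c)) * g t) has_derivative (\<lambda>h. 0)) (at t within {0..b})"
    if t: "t \<in> {0..b}" for t
  proof -
    have "((\<lambda>z. exp (- (z * c))) has_field_derivative - c * exp (- (of_real t * c))) (at (of_real t))"
      by (auto intro!: derivative_eq_intros)
    then have "((\<lambda>t. exp (- (of_real t * c))) has_vector_derivative - c * exp (- (of_real t * c)))
        (at t within {0..b})"
      by (rule has_vector_derivative_real_field)
    from has_vector_derivative_mult[OF this g'[OF t]]
    have "((\<lambda>t. exp (- (of_real t * c)) * g t) has_vector_derivative 0) (at t within {0..b})"
      by (simp add: algebra_simps)
    then show ?thesis
      by (simp add: has_vector_derivative_def)
  qed
  then have "exp (- (of_real b * c)) * g b = exp (- (of_real 0 * c)) * g 0"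
    by (rule has_derivative_zero_unique[of "{0..b}", rotated]) (use b in auto)
  then show ?thesis
    by (simp add: exp_minus field_simps)
qed

lemma integral_exp_tendsto:
  fixes \<mu> :: complex
  assumes "Re \<mu> < 0"
  shows "((\<lambda>t. integral {0..t} (\<lambda>\<tau>. exp (of_real \<tau> * \<mu>))) \<longlongrightarrow> - 1 / \<mu>) at_top"
proof -
  have \<mu>: "\<mu> \<noteq> 0"
    using assms by auto
  have int: "integral {0..t} (\<lambda>\<tau>. exp (of_real \<tau> * \<mu>)) = (exp (of_real t * \<mu>) - 1) / \<mu>" if "t \<ge> 0" for t
  proof -
    have "((\<lambda>\<tau>. exp (of_real \<tau> * \<mu>) / \<mu>) has_vector_derivative exp (of_real \<tau> * \<mu>))
        (at \<tau> within {0..t})" for \<tau>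
      by (rule has_vector_derivative_real_field[of "\<lambda>z. exp (z * \<mu>) / \<mu>"])
        (use \<mu> in \<open>auto intro!: derivative_eq_intros\<close>)
    from fundamental_theorem_of_calculus[OF that this] show ?thesis
      by (auto dest!: integral_unique simp: diff_divide_distrib)
  qed
  have "filterlim (\<lambda>t. Re \<mu> * t) at_bot at_top"
    using assms by (intro filterlim_tendsto_neg_mult_at_bot[OF tendsto_const]) (auto intro: filterlim_ident)
  then have "((\<lambda>t. exp (Re \<mu> * t)) \<longlongrightarrow> 0) at_top"
    by (rule filterlim_compose[OF exp_at_bot])
  then have "((\<lambda>t. exp (of_real t * \<mu>)) \<longlongrightarrow> 0) at_top"
    by (intro tendsto_norm_zero_cancel[of "\<lambda>t. exp (of_real t * \<mu>)"]) (simp add: mult.commute)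
  then have "((\<lambda>t. (exp (of_real t * \<mu>) - 1) / \<mu>) \<longlongrightarrow> (0 - 1) / \<mu>) at_top"
    by (intro tendsto_intros \<mu>)
  then have "((\<lambda>t. (exp (of_real t * \<mu>) - 1) / \<mu>) \<longlongrightarrow> - 1 / \<mu>) at_top"
    by simp
  moreover have "\<forall>\<^sub>F t in at_top. (exp (of_real t * \<mu>) - 1) / \<mu>
      = integral {0..t} (\<lambda>\<tau>. exp (of_real \<tau> * \<mu>))"
    using eventually_ge_at_top[of 0] by eventually_elim (simp add: int)
  ultimately show ?thesis
    by (rule Lim_transform_eventually)
qed

section \<open>Strongly continuous semigroups\<close>

context
  fixes T :: "real \<Rightarrow> 'h::complex_hilbert \<Rightarrow> 'h"
  assumes T: "c0_semigroup T"
begin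

lemma semigroup_clinear: "t \<ge> 0 \<Longrightarrow> bounded_clinear (T t)"
  and semigroup_linear: "t \<ge> 0 \<Longrightarrow> bounded_linear (T t)"
  and semigroup_0: "T 0 x = x"
  and semigroup_add: "s \<ge> 0 \<Longrightarrow> t \<ge> 0 \<Longrightarrow> T (s + t) x = T s (T t x)"
  and semigroup_at_right: "((\<lambda>t. T t x) \<longlongrightarrow> x) (at_right 0)"
  using T by (auto simp: c0_semigroup_def bounded_clinear_def)

lemma semigroup_near_0: "e > 0 \<Longrightarrow> \<exists>d>0. \<forall>h\<in>{0..d}. norm (T h x - x) < e"
proof -
  assume e: "e > 0"
  then have "\<forall>\<^sub>F h in at_right 0. norm (T h x - x) < e"
    using tendstoD[OF semigroup_at_right[of x] e] by (simp add: dist_norm)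
  then obtain d where d: "d > 0" "\<And>h. 0 < h \<Longrightarrow> h < d \<Longrightarrow> norm (T h x - x) < e"
    by (auto simp: eventually_at_right_field)
  have "\<forall>h\<in>{0..d/2}. norm (T h x - x) < e"
  proof
    fix h
    assume "h \<in> {0..d/2}"
    then show "norm (T h x - x) < e"
      using d e by (cases "h = 0") (auto simp: semigroup_0)
  qed
  then show ?thesis
    using d by (intro exI[of _ "d/2"]) auto
qed

text \<open>If the norms blew up along some \<open>t\<^sub>n \<rightarrow> 0\<close>, the operators \<open>T t\<^sub>n\<close> would still be pointwise
  bounded, as \<open>T t\<^sub>n x \<rightarrow> x\<close>, against the uniform boundedness principle.\<close>

lemma semigroup_bounded_near_0:
  obtains d M where "d > 0" "M \<ge> 1" "\<And>t x. t \<in> {0..d} \<Longrightarrow> norm (T t x) \<le> M * norm x"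
proof -
  have "\<exists>d>0. \<exists>M. \<forall>t\<in>{0..d}. \<forall>x. norm (T t x) \<le> M * norm x"
  proof (rule ccontr)
    assume contr: "\<not> ?thesis"
    have "\<exists>t\<in>{0..1 / Suc n}. \<exists>x. real n * norm x < norm (T t x)" for n
      using contr by (auto simp: not_le dest!: spec[of _ "1 / real (Suc n)"])
    then obtain t where t: "\<And>n. t n \<in> {0..1 / Suc n}" and big: "\<And>n. \<exists>x. real n * norm x < norm (T (t n) x)"
      by metis
    have ptw: "\<exists>K. \<forall>n. norm (T (t n) x) \<le> K" for x
    proof -
      have "(\<lambda>n. T (t n) x) \<longlonglongrightarrow> x"
        unfolding LIMSEQ_iff
      proof (intro allI impI)
        fix e :: real
        assume "e > 0"
        then obtain d where d: "d > 0" "\<forall>h\<in>{0..d}. norm (T h x - x) < e"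
          using semigroup_near_0 by blast
        obtain N where N: "1 / Suc N < d"
          using nat_approx_posE d(1) by blast
        have "t n \<in> {0..d}" if "n \<ge> N" for n
        proof -
          have "1 / real (Suc n) \<le> 1 / real (Suc N)"
            using that by (simp add: field_simps)
          then show ?thesis
            using t[of n] N by (simp del: of_nat_Suc)
        qed
        then show "\<exists>N. \<forall>n\<ge>N. norm (T (t n) x - x) < e"
          using d by blast
      qed
      then have "Bseq (\<lambda>n. T (t n) x)"
        using convergent_def convergent_imp_Bseq by blast
      then show ?thesis
        by (auto simp: Bseq_def)
    qed
    have "bounded_linear (T (t n))" for n
      using t[of n] by (intro semigroup_linear) simp
    then obtain K where K: "\<And>n x. norm (T (t n) x) \<le> K * norm x"
      using uniform_boundedness[of "\<lambda>n. T (t n)"] ptw by metis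
    obtain n where "K \<le> real n"
      using real_arch_simple by blast
    then have "norm (T (t n) x) \<le> real n * norm x" for x
      using K[of n x] by (meson mult_right_mono norm_ge_zero order_trans)
    then show False
      using big[of n] by (auto simp: not_less[symmetric])
  qed
  then obtain d M where d: "d > 0" and M: "\<And>t x. t \<in> {0..d} \<Longrightarrow> norm (T t x) \<le> M * norm x"
    by blast
  have "norm (T t x) \<le> max 1 M * norm x" if "t \<in> {0..d}" for t x
    using M[OF that, of x] by (meson max.cobounded2 mult_right_mono norm_ge_zero order_trans)
  then show ?thesis
    using that[of d "max 1 M"] d by simp
qed

lemma semigroup_locally_bounded:
  obtains M where "M \<ge> 1" "\<And>t x. t \<in> {0..b} \<Longrightarrow> norm (T t x) \<le> M * norm x"
proof -
  obtain d M where d: "d > 0" and M: "M \<ge> 1" and bd: "\<And>t x. t \<in> {0..d} \<Longrightarrow> norm (T t x) \<le> M * norm x"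
    using semigroup_bounded_near_0 by blast
  have step: "norm (T t x) \<le> M ^ Suc n * norm x" if "t \<in> {0..real n * d}" for n t x
    using that
  proof (induction n arbitrary: t x)
    case 0
    then show ?case
      using M by (simp add: semigroup_0 mult_le_cancel_right1)
  next
    case (Suc n)
    show ?case
    proof (cases "t \<le> d")
      case True
      then have "norm (T t x) \<le> M * norm x"
        using Suc.prems by (intro bd) simp
      also have "\<dots> \<le> M ^ Suc (Suc n) * norm x"
        using M by (intro mult_right_mono) (auto intro: self_le_power[of M "Suc (Suc n)", simplified])
      finally show ?thesis .
    next
      case False
      have "T t x = T d (T (t - d) x)"
        using semigroup_add[of d "t - d" x] d False by simp
      also have "norm \<dots> \<le> M * norm (T (t - d) x)"
        using d by (intro bd) simp
      also have "\<dots> \<le> M * (M ^ Suc n * norm x)"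
        using M Suc.prems False by (intro mult_left_mono Suc.IH) (auto simp: algebra_simps)
      finally show ?thesis
        by simp
    qed
  qed
  obtain n where "b / d \<le> real n"
    using real_arch_simple by blast
  then have "b \<le> real n * d"
    using d by (simp add: field_simps)
  then have "norm (T t x) \<le> M ^ Suc n * norm x" if "t \<in> {0..b}" for t x
    using that by (intro step) auto
  moreover have "M ^ Suc n \<ge> 1"
    using M by (rule one_le_power)
  ultimately show ?thesis
    using that by blast
qed

text \<open>The definition gives continuity at \<open>0\<close> from the right only. At other times, continuity from the
  left needs the local bound: \<open>T r x - T s x = T s (T (r - s) x - x)\<close> for \<open>s \<le> r\<close>, where \<open>s\<close> varies
  as \<open>r\<close> is approached.\<close>

lemma semigroup_strongly_continuous: "continuous_on {0..b} (\<lambda>t. T t x)"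
  unfolding continuous_on_iff
proof (intro ballI allI impI)
  fix t e :: real
  assume t: "t \<in> {0..b}" and e: "e > 0"
  obtain M where M: "M \<ge> 1" "\<And>t x. t \<in> {0..b} \<Longrightarrow> norm (T t x) \<le> M * norm x"
    using semigroup_locally_bounded by blast
  obtain d where d: "d > 0" "\<And>h. h \<in> {0..d} \<Longrightarrow> norm (T h x - x) < e / M"
    using semigroup_near_0[of "e / M" x] e M by auto
  have *: "norm (T r x - T s x) < e" if "s \<in> {0..b}" "s \<le> r" "r - s < d" for r s
  proof -
    interpret bounded_linear "T s"
      using that by (intro semigroup_linear) simp
    have "T r x - T s x = T s (T (r - s) x - x)"
      using semigroup_add[of s "r - s" x] that by (simp add: diff)
    also have "norm \<dots> \<le> M * norm (T (r - s) x - x)"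
      using that by (intro M)
    also have "\<dots> < M * (e / M)"
      using that M by (intro mult_strict_left_mono d) auto
    finally show ?thesis
      using M by simp
  qed
  have "dist (T s x) (T t x) < e" if "s \<in> {0..b}" "dist s t < d" for s
    using *[of s t] *[of t s] that t by (cases "s \<le> t") (auto simp: dist_norm norm_minus_commute)
  then show "\<exists>d>0. \<forall>s\<in>{0..b}. dist s t < d \<longrightarrow> dist (T s x) (T t x) < e"
    using d by blast
qed

lemma orbit_integrable: "(\<lambda>t. T t x) integrable_on {a..b}" if "a \<ge> 0"
  by (rule integrable_continuous_real, rule continuous_on_subset[OF semigroup_strongly_continuous[of b]])
    (use that in auto)

text \<open>By the semigroup law, \<open>T h\<close> shifts the interval of integration by \<open>h\<close>. In the difference the
  overlap cancels, leaving the averages of the orbit over \<open>[t, t + h]\<close> and \<open>[0, h]\<close>.\<close>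

lemma generator_integral:
  assumes t: "t \<ge> 0"
  shows "((\<lambda>h. (1 / h) *\<^sub>R (T h (integral {0..t} (\<lambda>s. T s x)) - integral {0..t} (\<lambda>s. T s x)))
    \<longlongrightarrow> T t x - x) (at_right 0)"
proof -
  let ?F = "\<lambda>a b. integral {a..b} (\<lambda>s. T s x)"
  have shift: "integral {0..b} (\<lambda>s. T s (T a x)) = ?F a (b + a)" if "a \<ge> 0" for a b
  proof -
    have "integral {0..b} (\<lambda>s. T s (T a x)) = integral {0..b} (\<lambda>s. T (s + a) x)"
      by (rule integral_cong) (use that in \<open>simp add: semigroup_add\<close>)
    also have "\<dots> = ?F a (b + a)"
      using integral_shift_real_ivl[of a a "b + a" "\<lambda>s. T s x"] by simp
    finally show ?thesis .
  qed
  have eq: "T h (?F 0 t) - ?F 0 t = integral {0..h} (\<lambda>s. T s (T t x)) - ?F 0 h" if h: "h > 0" for h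
  proof -
    have "T h (?F 0 t) = integral {0..t} (\<lambda>s. T h (T s x))"
      using integral_linear[OF orbit_integrable[of 0 x t] semigroup_linear[of h]] h
      by (simp add: o_def)
    also have "\<dots> = integral {0..t} (\<lambda>s. T s (T h x))"
      by (rule integral_cong) (use h in \<open>simp flip: semigroup_add add: add.commute\<close>)
    also have "\<dots> = ?F h (t + h)"
      using h by (intro shift) simp
    finally have 1: "T h (?F 0 t) = ?F h (t + h)" .
    have 2: "?F 0 h + ?F h (t + h) = ?F 0 (t + h)"
      using h t by (intro Henstock_Kurzweil_Integration.integral_combine orbit_integrable) auto
    have 3: "?F 0 t + ?F t (t + h) = ?F 0 (t + h)"
      using h t by (intro Henstock_Kurzweil_Integration.integral_combine orbit_integrable) auto
    show ?thesis
      using 1 2 3 shift[OF t, of h] by (simp add: algebra_simps)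
  qed
  have "((\<lambda>h. (1 / h) *\<^sub>R integral {0..h} (\<lambda>s. T s (T t x)) - (1 / h) *\<^sub>R ?F 0 h)
      \<longlongrightarrow> T 0 (T t x) - T 0 x) (at_right 0)"
    by (intro tendsto_diff tendsto_integral_average semigroup_strongly_continuous)
  moreover have "\<forall>\<^sub>F h in at_right 0. (1 / h) *\<^sub>R integral {0..h} (\<lambda>s. T s (T t x)) - (1 / h) *\<^sub>R ?F 0 h
      = (1 / h) *\<^sub>R (T h (?F 0 t) - ?F 0 t)"
    unfolding eventually_at_right_field
    by (rule exI[of _ 1]) (simp add: eq scaleR_diff_right)
  ultimately show ?thesis
    unfolding semigroup_0 by (rule Lim_transform_eventually)
qed

end

section \<open>Generators and eigenvectors of the adjoint\<close>

context
  fixes D :: "'h::complex_hilbert set" and A T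
  assumes gen: "generates D A T"
begin

lemma generates_semigroup: "c0_semigroup T"
  using gen by (simp add: generates_def)

lemma integral_orbit_in_domain:
  assumes "t \<ge> 0"
  shows "integral {0..t} (\<lambda>s. T s x) \<in> D" "A (integral {0..t} (\<lambda>s. T s x)) = T t x - x"
proof -
  let ?y = "integral {0..t} (\<lambda>s. T s x)"
  have lim: "((\<lambda>h. (1 / h) *\<^sub>R (T h ?y - ?y)) \<longlongrightarrow> T t x - x) (at_right 0)"
    by (rule generator_integral[OF generates_semigroup assms])
  then show "?y \<in> D"
    using gen by (auto simp: generates_def)
  then have "((\<lambda>h. (1 / h) *\<^sub>R (T h ?y - ?y)) \<longlongrightarrow> A ?y) (at_right 0)"
    using gen by (auto simp: generates_def)
  then show "A ?y = T t x - x"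
    using lim by (rule tendsto_unique[OF trivial_limit_at_right_real])
qed

text \<open>Density in the form in which it is used: the averages of the orbit of \<open>z\<close> over \<open>[0, h]\<close> lie in
  \<open>D\<close> and converge to \<open>z\<close>, so a vector orthogonal to \<open>D\<close> is orthogonal to itself.\<close>

lemma generator_domain_dense:
  assumes "\<And>x. x \<in> D \<Longrightarrow> cinner x z = 0"
  shows "z = 0"
proof -
  have "((\<lambda>h. cinner ((1 / h) *\<^sub>R integral {0..h} (\<lambda>s. T s z)) z) \<longlongrightarrow> cinner (T 0 z) z) (at_right 0)"
    by (intro bounded_linear.tendsto[OF bounded_linear_cinner_left] tendsto_integral_average
        semigroup_strongly_continuous generates_semigroup)
  moreover have "\<forall>\<^sub>F h in at_right 0. cinner ((1 / h) *\<^sub>R integral {0..h} (\<lambda>s. T s z)) z = 0"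
    unfolding eventually_at_right_field
    by (rule exI[of _ 1]) (simp add: cinner_scaleR_left assms integral_orbit_in_domain)
  ultimately have "cinner (T 0 z) z = 0"
    by (intro tendsto_unique[OF trivial_limit_at_right_real _ tendsto_eventually])
  then show ?thesis
    using generates_semigroup by (simp add: semigroup_0 cinner_self)
qed

lemma generator_adj:
  assumes y: "y \<in> adj_dom D A" and x: "x \<in> D"
  shows "cinner (A x) y = cinner x (adj D A y)"
proof -
  obtain z where z: "\<forall>x\<in>D. cinner (A x) y = cinner x z"
    using y by (auto simp: adj_dom_def)
  have unique: "z' = z" if "\<forall>x\<in>D. cinner (A x) y = cinner x z'" for z'
    using generator_domain_dense[of "z' - z"] that z by (simp add: cinner_diff_right)
  have "adj D A y = z"
    unfolding adj_def by (rule the_equality) (rule z, rule unique)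
  then show ?thesis
    using z x by simp
qed

text \<open>Pairing \<open>A (\<integral>\<^sub>0\<^sup>t T s x ds) = T t x - x\<close> with the eigenvector shows that
  \<open>t \<mapsto> \<langle>T t x, u\<rangle>\<close> solves the integral equation of an exponential. The test vector \<open>x\<close> ranges over
  the whole space, since the integral is in the domain whether or not \<open>x\<close> is.\<close>

lemma adj_semigroup_eigenvector:
  assumes ev: "eigenvector (adj_dom D A) (adj D A) \<mu> u" and t: "t \<ge> 0"
  shows "adj UNIV (T t) u = exp (of_real t * \<mu>) *\<^sub>C u"
proof (rule adj_eqI)
  fix x
  note T = generates_semigroup
  have u: "u \<in> adj_dom D A" "adj D A u = \<mu> *\<^sub>C u"
    using ev by (auto simp: eigenvector_def)
  have "cinner (T b x) u = exp (of_real b * \<mu>) * cinner (T 0 x) u" if "b \<ge> 0" for b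
  proof (rule volterra_exponential[OF _ that])
    show "continuous_on {0..b} (\<lambda>t. cinner (T t x) u)"
      by (intro bounded_linear.continuous_on[OF bounded_linear_cinner_left]
          semigroup_strongly_continuous T)
    fix t
    assume "t \<in> {0..b}"
    then have t: "t \<ge> 0"
      by simp
    let ?y = "integral {0..t} (\<lambda>s. T s x)"
    have "cinner (T t x) u - cinner (T 0 x) u = cinner (A ?y) u"
      by (simp add: integral_orbit_in_domain[OF t] semigroup_0[OF T] cinner_diff_left)
    also have "\<dots> = \<mu> * cinner ?y u"
      by (simp add: generator_adj[OF u(1) integral_orbit_in_domain(1)[OF t]] u(2) cinner_scaleC_right)
    also have "cinner ?y u = integral {0..t} (\<lambda>s. cinner (T s x) u)"
      using integral_linear[OF orbit_integrable[OF T, of 0 x t] bounded_linear_cinner_left[of u]]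
      by (simp add: o_def)
    finally show "cinner (T t x) u = cinner (T 0 x) u + \<mu> * integral {0..t} (\<lambda>s. cinner (T s x) u)"
      by (simp add: algebra_simps)
  qed
  from this[OF t] show "cinner (T t x) u = cinner x (exp (of_real t * \<mu>) *\<^sub>C u)"
    by (simp add: semigroup_0[OF T] cinner_scaleC_right)
qed

section \<open>The covariance on eigenvectors\<close>

text \<open>The factor \<open>adj UNIV (T \<tau>)\<close> acts on \<open>u\<close> directly, and \<open>T \<tau>\<close> acts on \<open>v\<close> after being
  moved across the inner product. The conjugate-linear first argument turns
  \<open>exp (\<tau> cnj \<nu>)\<close> into \<open>exp (\<tau> \<nu>)\<close>, which is why \<open>\<nu> + cnj \<mu>\<close> appears.\<close>

lemma cinner_covariance_eigenvectors:
  assumes u: "eigenvector (adj_dom D A) (adj D A) (cnj \<nu>) u"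
    and v: "eigenvector (adj_dom D A) (adj D A) (cnj \<mu>) v"
    and G: "bounded_clinear G"
  shows "cinner (covariance T G \<sigma> t u) v
    = of_real (\<sigma>\<^sup>2) * cinner (G u) v * integral {0..t} (\<lambda>\<tau>. exp (of_real \<tau> * (\<nu> + cnj \<mu>)))"
proof -
  note T = generates_semigroup
  let ?f = "\<lambda>\<tau>. exp (of_real \<tau> * cnj \<nu>) *\<^sub>C T \<tau> (G u)"
  have f: "T \<tau> (G (adj UNIV (T \<tau>) u)) = ?f \<tau>" if "\<tau> \<in> {0..t}" for \<tau>
    using that G semigroup_clinear[OF T, of \<tau>]
    by (simp add: adj_semigroup_eigenvector[OF u] bounded_clinear_def)
  have "continuous_on {0..t} ?f"
    by (intro bounded_bilinear.continuous_on[OF bounded_bilinear_scaleC]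
        semigroup_strongly_continuous T continuous_intros)
  then have int: "?f integrable_on {0..t}"
    by (rule integrable_continuous_real)
  have "integral {0..t} (\<lambda>\<tau>. T \<tau> (G (adj UNIV (T \<tau>) u))) = integral {0..t} ?f"
    by (rule integral_cong) (rule f)
  then have "cinner (covariance T G \<sigma> t u) v = of_real (\<sigma>\<^sup>2) * cinner (integral {0..t} ?f) v"
    by (simp add: covariance_def cinner_scaleR_left)
  also have "cinner (integral {0..t} ?f) v = integral {0..t} (\<lambda>\<tau>. cinner (?f \<tau>) v)"
    using integral_linear[OF int bounded_linear_cinner_left[of v]] by (simp add: o_def)
  also have "\<dots> = integral {0..t} (\<lambda>\<tau>. cinner (G u) v * exp (of_real \<tau> * (\<nu> + cnj \<mu>)))"
  proof (rule integral_cong)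
    fix \<tau>
    assume "\<tau> \<in> {0..t}"
    then have \<tau>: "\<tau> \<ge> 0"
      by simp
    have "cinner (T \<tau> (G u)) v = cinner (G u) (exp (of_real \<tau> * cnj \<mu>) *\<^sub>C v)"
      unfolding cinner_adj[OF semigroup_clinear[OF T \<tau>]] adj_semigroup_eigenvector[OF v \<tau>] ..
    then show "cinner (?f \<tau>) v = cinner (G u) v * exp (of_real \<tau> * (\<nu> + cnj \<mu>))"
      by (simp add: cinner_scaleC_left cinner_scaleC_right exp_cnj distrib_left exp_add)
  qed
  finally show ?thesis
    by simp
qed

lemma cinner_limit_covariance:
  assumes u: "eigenvector (adj_dom D A) (adj D A) (cnj \<nu>) u"
    and v: "eigenvector (adj_dom D A) (adj D A) (cnj \<mu>) v"
    and G: "bounded_clinear G"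
    and neg: "Re \<nu> < 0" "Re \<mu> < 0"
    and lim: "((\<lambda>t. covariance T G \<sigma> t u) \<longlongrightarrow> w) at_top"
  shows "cinner w v = - of_real (\<sigma>\<^sup>2) * (cinner (G u) v / (\<nu> + cnj \<mu>))"
proof -
  have "((\<lambda>t. cinner (covariance T G \<sigma> t u) v) \<longlongrightarrow> cinner w v) at_top"
    by (intro bounded_linear.tendsto[OF bounded_linear_cinner_left] lim)
  moreover have "((\<lambda>t. cinner (covariance T G \<sigma> t u) v)
      \<longlongrightarrow> of_real (\<sigma>\<^sup>2) * cinner (G u) v * (- 1 / (\<nu> + cnj \<mu>))) at_top"
    unfolding cinner_covariance_eigenvectors[OF u v G]
    by (intro tendsto_mult tendsto_const integral_exp_tendsto) (use neg in simp)
  ultimately show ?thesis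
    using tendsto_unique[OF trivial_limit_at_top_linorder] by fastforce
qed

end

text \<open>The denominator is \<open>2 Re (\<nu> p)\<close>, and the numerator stays bounded by the Cauchy-Schwarz
  inequality.\<close>

lemma diagonal_quotient_bigo:
  fixes G :: "'h::complex_hilbert \<Rightarrow> 'h"
  assumes G: "bounded_clinear G" and bdd: "Bfun u F"
  shows "(\<lambda>p. c * (cinner (G (u p)) (u p) / (\<nu> p + cnj (\<nu> p)))) \<in> O[F](\<lambda>p. complex_of_real (1 / Re (\<nu> p)))"
proof -
  obtain M where M: "M > 0" "\<forall>\<^sub>F p in F. norm (u p) \<le> M"
    using bdd by (auto simp: Bfun_def)
  obtain K where K: "K \<ge> 0" "\<And>x. norm (G x) \<le> norm x * K"
    using bounded_linear.nonneg_bounded[of G] G by (auto simp: bounded_clinear_def)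
  show ?thesis
  proof (rule bigoI)
    show "\<forall>\<^sub>F p in F. norm (c * (cinner (G (u p)) (u p) / (\<nu> p + cnj (\<nu> p))))
        \<le> cmod c * (M * K * M / 2) * norm (complex_of_real (1 / Re (\<nu> p)))"
      using M(2)
    proof eventually_elim
      case (elim p)
      have "cmod (cinner (G (u p)) (u p)) \<le> norm (G (u p)) * norm (u p)"
        by (rule cauchy_schwarz)
      also have "\<dots> \<le> (M * K) * M"
        using elim K M by (intro mult_mono order_trans[OF K(2)]) auto
      finally have "cmod (cinner (G (u p)) (u p)) / (2 * \<bar>Re (\<nu> p)\<bar>) \<le> (M * K * M) / (2 * \<bar>Re (\<nu> p)\<bar>)"
        by (rule divide_right_mono) simp
      from mult_left_mono[OF this norm_ge_zero[of c]] show ?case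
        by (simp add: complex_add_cnj norm_mult norm_divide)
    qed
  qed
qed

theorem theorem3p2:
  fixes D :: "real \<Rightarrow> 'h::complex_hilbert set"
    and A :: "real \<Rightarrow> 'h \<Rightarrow> 'h"
    and T :: "real \<Rightarrow> real \<Rightarrow> 'h \<Rightarrow> 'h"
    and Q Qh B :: "'h \<Rightarrow> 'h"
    and \<sigma> :: real
    and Vinf :: "real \<Rightarrow> 'h \<Rightarrow> 'h"
    and lam :: "real \<Rightarrow> nat \<Rightarrow> complex"
    and u :: "real \<Rightarrow> nat \<Rightarrow> 'h"
    and ks :: nat
  assumes generator: "\<And>p. generates (D p) (A p) (T p)"
    and Q: "nonneg_selfadjoint Q"
    and sqrt_Q: "nonneg_selfadjoint Qh" "\<And>x. Qh (Qh x) = Q x"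
    and B: "hilbert_schmidt (range Qh) (range_inner Qh) B"
    and sigma: "\<sigma> > 0"
    and Vinf: "\<And>p x. p < 0 \<Longrightarrow> ((\<lambda>t. covariance (T p) (BQB B Qh) \<sigma> t x) \<longlongrightarrow> Vinf p x) at_top"
    and discrete: "\<And>p. p \<le> 0 \<Longrightarrow> discrete_spectrum (D p) (A p)"
    and eigenvalues: "\<And>p. p \<le> 0 \<Longrightarrow> spectrum (D p) (A p) = range (lam p)"
    and eigenfunctions: "\<And>p k. p \<le> 0 \<Longrightarrow>
          eigenvector (adj_dom (D p) (A p)) (adj (D p) (A p)) (cnj (lam p k)) (u p k)"
    and stable: "\<And>p k. p < 0 \<Longrightarrow> Re (lam p k) < 0"
    and critical: "Re (lam 0 ks) = 0"
    and generic: "cinner (BQB B Qh (u 0 ks)) (u 0 ks) \<noteq> 0"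
    and normalised: "Bfun (\<lambda>p. u p ks) (at_left 0)"
  shows "(\<forall>p<0. \<forall>j k. cinner (Vinf p (u p k)) (u p j) =
            - complex_of_real (\<sigma>\<^sup>2) * (cinner (BQB B Qh (u p k)) (u p j) / (lam p k + cnj (lam p j))))
       \<and> (\<lambda>p. cinner (Vinf p (u p ks)) (u p ks))
            \<in> O[at_left 0](\<lambda>p. complex_of_real (1 / Re (lam p ks)))"
proof -
  have G: "bounded_clinear (BQB B Qh)"
    using sqrt_Q(1) B by (intro bounded_clinear_BQB) (auto simp: nonneg_selfadjoint_def)
  have formula: "cinner (Vinf p (u p k)) (u p j)
      = - complex_of_real (\<sigma>\<^sup>2) * (cinner (BQB B Qh (u p k)) (u p j) / (lam p k + cnj (lam p j)))"
    if p: "p < 0" for p j k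
    using p by (intro cinner_limit_covariance[OF generator eigenfunctions eigenfunctions G] stable Vinf) auto
  have big: "(\<lambda>p. - complex_of_real (\<sigma>\<^sup>2) *
        (cinner (BQB B Qh (u p ks)) (u p ks) / (lam p ks + cnj (lam p ks))))
      \<in> O[at_left 0](\<lambda>p. complex_of_real (1 / Re (lam p ks)))"
    by (rule diagonal_quotient_bigo[OF G normalised])
  have "\<forall>\<^sub>F p in at_left 0. - complex_of_real (\<sigma>\<^sup>2) *
        (cinner (BQB B Qh (u p ks)) (u p ks) / (lam p ks + cnj (lam p ks)))
      = cinner (Vinf p (u p ks)) (u p ks)"
    unfolding eventually_at_left_field by (rule exI[of _ "-1"]) (simp add: formula)
  from iffD1[OF landau_o.big.in_cong[OF this] big]
  show ?thesis
    using formula by blast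
qed

end
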